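(* For every integer $t\ge 3$, there exist two triplets of non $\epsilon$-cospectral $\epsilon$-equienergetic graphs on $6+12t$ vertices.
   Context: All graphs are finite, simple, undirected and connected. For a connected graph $G$ with distance function $d$, the eccentricity of a vertex $v$ is $e(v)=\max\{d(v,u):u\in V(G)\}$. The eccentricity matrix $\epsilon(G)$ is the symmetric matrix indexed by $V(G)$ with $(u,v)$ entry $d(u,v)$ if $d(u,v)=\min\{e(u),e(v)\}$, and $0$ otherwise. The $\epsilon$-spectrum of $G$ is the multiset of eigenvalues of $\epsilon(G)$, and the $\epsilon$-energy is the sum of the absolute values of these eigenvalues (with multiplicity). Two non-isomorphic graphs of the same order are $\epsilon$-cospectral if they have the same $\epsilon$-spectrum, and non $\epsilon$-cospectral otherwise. Two graphs of the same order are $\epsilon$-equienergetic if they have the same $\epsilon$-energy. "Two triplets" means two different (unordered) triplets of graphs up to isomorphism, each triplet consisting of three graphs that are pairwise non $\epsilon$-cospectral and pairwise $\epsilon$-equienergetic. *)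

theory Defs
  imports
    "Graph_Theory.Graph_Theory"
    "Jordan_Normal_Form.Char_Poly"
    "HOL-Computational_Algebra.Fundamental_Theorem_Algebra"
begin

text \<open>
  An undirected graph is a symmetric digraph (\<open>pair_graph\<close>: finite, no loops, arcs are
  ordered pairs of vertices, symmetric). To index matrices, graphs of order \<open>n\<close> live on
  the vertex set \<open>{..<n}\<close>; up to isomorphism this is no restriction.
\<close>

definition connected_graph_of_order :: "nat \<Rightarrow> nat pair_pre_digraph \<Rightarrow> bool" where
  "connected_graph_of_order n G \<longleftrightarrow>
     pair_graph G \<and> Digraph_Component.connected (with_proj G) \<and> pverts G = {..<n}"

abbreviation order_of :: "'a pair_pre_digraph \<Rightarrow> nat" where
  "order_of G \<equiv> card (pverts G)"

abbreviation isomorphic :: "'a pair_pre_digraph \<Rightarrow> 'b pair_pre_digraph \<Rightarrow> bool" where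
  "isomorphic G H \<equiv> digraph_iso (with_proj G) (with_proj H)"

text \<open>
  Every arc has weight 1, so \<open>\<mu>\<close> is the least length of a walk; it is a finite \<open>ereal\<close>
  whenever \<open>G\<close> is connected.
\<close>

definition graph_dist :: "'a pair_pre_digraph \<Rightarrow> 'a \<Rightarrow> 'a \<Rightarrow> real" where
  "graph_dist G u v = real_of_ereal (wf_digraph.\<mu> (with_proj G) (\<lambda>_. 1) u v)"

definition eccentricity :: "'a pair_pre_digraph \<Rightarrow> 'a \<Rightarrow> real" where
  "eccentricity G v = Max (graph_dist G v ` pverts G)"

text \<open>Meaningful for graphs with vertex set \<open>{..<order_of G}\<close>.\<close>

definition eps_matrix :: "nat pair_pre_digraph \<Rightarrow> real mat" where
  "eps_matrix G = mat (order_of G) (order_of G) (\<lambda>(u, v).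
     if graph_dist G u v = min (eccentricity G u) (eccentricity G v)
     then graph_dist G u v else 0)"

text \<open>
  The eigenvalues are taken over the complex numbers, so that the multiset always has
  \<open>order_of G\<close> elements; since the matrix is symmetric, they are all real.
\<close>

definition eps_spectrum :: "nat pair_pre_digraph \<Rightarrow> complex multiset" where
  "eps_spectrum G = proots (char_poly (map_mat complex_of_real (eps_matrix G)))"

definition eps_energy :: "nat pair_pre_digraph \<Rightarrow> real" where
  "eps_energy G = (\<Sum>x\<in>#eps_spectrum G. cmod x)"

definition non_eps_cospectral :: "nat pair_pre_digraph \<Rightarrow> nat pair_pre_digraph \<Rightarrow> bool" where
  "non_eps_cospectral G H \<longleftrightarrow>
     order_of G = order_of H \<and> \<not> isomorphic G H \<and> eps_spectrum G \<noteq> eps_spectrum H"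

definition eps_equienergetic :: "nat pair_pre_digraph \<Rightarrow> nat pair_pre_digraph \<Rightarrow> bool" where
  "eps_equienergetic G H \<longleftrightarrow> order_of G = order_of H \<and> eps_energy G = eps_energy H"

definition equienergetic_triplet :: "nat \<Rightarrow> nat pair_pre_digraph set \<Rightarrow> bool" where
  "equienergetic_triplet n T \<longleftrightarrow>
     card T = 3 \<and> (\<forall>G\<in>T. connected_graph_of_order n G) \<and>
     pairwise non_eps_cospectral T \<and> pairwise eps_equienergetic T"

definition same_up_to_iso :: "'a pair_pre_digraph set \<Rightarrow> 'a pair_pre_digraph set \<Rightarrow> bool" where
  "same_up_to_iso S T \<longleftrightarrow>
     (\<forall>G\<in>S. \<exists>H\<in>T. isomorphic G H) \<and> (\<forall>H\<in>T. \<exists>G\<in>S. isomorphic G H)"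

end

(*
  The eps-matrix of the complete bipartite graph K(a,b) with a, b >= 2 is block diagonal with
  blocks 2(J - I): all eccentricities are 2, so exactly the pairs at distance 2 survive. The
  block of size k has the eigenvalues 2(k - 1), once, and -2, with multiplicity k - 1; hence
  the eps-energy is 4(a + b - 2) and depends only on the order, while the spectrum determines
  {a, b}. With n = 6 + 12 t, the graphs K(a, n - a) for a in {2, 3, 4} and for a in {2, 3, 5}
  are the two triplets.
*)

theory Submission
  imports Defs
begin

section \<open>Characteristic polynomials of block triangular matrices and of c (J - I)\<close>

lemma char_poly_four_block_lower_left_zero:
  fixes A1 :: "'a :: idom mat"
  assumes A1: "A1 \<in> carrier_mat n n" and A2: "A2 \<in> carrier_mat n m"
    and A4: "A4 \<in> carrier_mat m m"
  shows "char_poly (four_block_mat A1 A2 (0\<^sub>m m n) A4) = char_poly A1 * char_poly A4"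
proof -
  let ?cm = "\<lambda>A. [:0, 1:] \<cdot>\<^sub>m 1\<^sub>m (dim_row A) + map_mat (\<lambda>a. [:- a:]) A"
  let ?A = "four_block_mat A1 A2 (0\<^sub>m m n) A4"
  \<comment> \<open>Passing from A to X I - A respects the blocks: the identity meets only the
    diagonal blocks, and the zero block stays zero. So the determinant factors.\<close>
  have "?cm ?A = four_block_mat (?cm A1) (map_mat (\<lambda>a. [:- a:]) A2) (0\<^sub>m m n) (?cm A4)"
    by (rule eq_matI, insert A1 A2 A4, auto simp: one_poly_def)
  moreover have "det \<dots> = det (?cm A1) * det (?cm A4)"
    by (rule det_four_block_mat_lower_left_zero, insert A1 A2 A4, auto)
  ultimately show ?thesis
    unfolding char_poly_defs using A1 A4 by simp
qed

text \<open>This is c (J - I), over any commutative ring because it serves both the real eps-matrix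
  and its complex image.\<close>

definition const_offdiag_mat :: "nat \<Rightarrow> 'a :: comm_ring_1 \<Rightarrow> 'a mat" where
  "const_offdiag_mat n c = mat n n (\<lambda>(i, j). if i = j then 0 else c)"

lemma const_offdiag_mat_carrier [simp]: "const_offdiag_mat n c \<in> carrier_mat n n"
  by (simp add: const_offdiag_mat_def)

text \<open>A change of basis: for s = 1 the columns are the all-ones vector, an eigenvector of J -
  I, followed by the unit vectors except the first. Negating s inverts the matrix.\<close>

definition first_col_mat :: "nat \<Rightarrow> 'a :: comm_ring_1 \<Rightarrow> 'a mat" where
  "first_col_mat n s = mat n n (\<lambda>(i, j). if i = j then 1 else if j = 0 then s else 0)"

lemma first_col_mat_carrier [simp]: "first_col_mat n s \<in> carrier_mat n n"
  by (simp add: first_col_mat_def)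

lemma first_col_mat_mult:
  fixes B :: "'a :: comm_ring_1 mat"
  assumes B: "B \<in> carrier_mat n m"
  shows "first_col_mat n s * B
    = mat n m (\<lambda>(i, j). if i = 0 then B $$ (0, j) else B $$ (i, j) + s * B $$ (0, j))"
    (is "_ = ?R")
proof (rule eq_matI)
  fix i j assume "i < dim_row ?R" "j < dim_col ?R"
  then have ij: "i < n" "j < m" by auto
  have "(first_col_mat n s * B) $$ (i, j)
    = (\<Sum>k\<in>{0..<n}. (if i = k then 1 else if k = 0 then s else 0) * B $$ (k, j))"
    using B ij by (auto simp: first_col_mat_def scalar_prod_def intro!: sum.cong)
  \<comment> \<open>Row i of the left factor has a diagonal entry and an entry in column 0; for i =
    0 these coincide and must be counted once.\<close>
  also have "\<dots> = (\<Sum>k\<in>{0..<n}. (if k = i then B $$ (i, j) else 0)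
      + (if k = 0 then (if i = 0 then 0 else s * B $$ (0, j)) else 0))"
    by (rule sum.cong) auto
  also have "\<dots> = ?R $$ (i, j)"
    using ij by (simp add: sum.distrib)
  finally show "(first_col_mat n s * B) $$ (i, j) = ?R $$ (i, j)" .
qed (use B in \<open>auto simp: first_col_mat_def\<close>)

lemma first_col_mat_mult_uminus:
  "first_col_mat n s * first_col_mat n (- s) = 1\<^sub>m n"
  by (subst first_col_mat_mult[OF first_col_mat_carrier], rule eq_matI)
    (auto simp: first_col_mat_def)

text \<open>In the basis given by \<open>first_col_mat n 1\<close> the matrix becomes upper
  triangular, so its diagonal can be read off. No division occurs, hence any commutative ring will
  do.\<close>

lemma char_poly_const_offdiag_mat:
  fixes c :: "'a :: comm_ring_1"
  assumes n: "n > 0"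
  shows "char_poly (const_offdiag_mat n c) = [:- (of_nat (n - 1) * c), 1:] * [:c, 1:] ^ (n - 1)"
proof -
  let ?A = "const_offdiag_mat n c"
  let ?P = "first_col_mat n 1 :: 'a mat" and ?Q = "first_col_mat n (- 1) :: 'a mat"
  \<comment> \<open>The columns of \<open>T\<close> record the images of the basis: the all-ones
    vector 1 goes to (n - 1) c 1, and a unit vector e_j with j > 0 goes to c 1 - c e_j.\<close>
  define T where "T = mat n n (\<lambda>(i, j). if i = 0 then if j = 0 then of_nat (n - 1) * c else c
    else if i = j then - c else 0)"
  have T: "T \<in> carrier_mat n n" by (simp add: T_def)
  have row_sum: "(\<Sum>k\<in>{0..<n}. ?A $$ (i, k)) = of_nat (n - 1) * c" if "i < n" for i
  proof -
    have "(\<Sum>k\<in>{0..<n}. ?A $$ (i, k)) = (\<Sum>k\<in>{0..<n} - {i}. c)"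
      using that by (intro sum.mono_neutral_cong_right) (auto simp: const_offdiag_mat_def)
    then show ?thesis using that by simp
  qed
  have "?A * ?P = ?P * T"
    unfolding first_col_mat_mult[OF T]
  proof (rule eq_matI, goal_cases)
    case (1 i j)
    then have ij: "i < n" "j < n" by auto
    \<comment> \<open>Right multiplication by \<open>?P\<close> replaces column 0 by the row sums
      and keeps the other columns.\<close>
    have "(?A * ?P) $$ (i, j)
      = (\<Sum>k\<in>{0..<n}. ?A $$ (i, k) * (if k = j then 1 else if j = 0 then 1 else 0))"
      using ij by (auto simp: const_offdiag_mat_def first_col_mat_def scalar_prod_def intro!: sum.cong)
    also have "\<dots> = (if j = 0 then of_nat (n - 1) * c else ?A $$ (i, j))"
      (is "?S = _")
    proof (cases "j = 0")
      case False
      then have "?S = (\<Sum>k\<in>{0..<n}. if k = j then ?A $$ (i, k) else 0)"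
        by (intro sum.cong) auto
      with False ij show ?thesis by simp
    qed (use row_sum[OF ij(1)] in simp)
    finally show ?case
      using ij by (auto simp: T_def const_offdiag_mat_def)
  qed (auto simp: const_offdiag_mat_def first_col_mat_def)
  then have "?A * ?P * ?Q = ?P * T * ?Q" by simp
  then have "?A = ?P * T * ?Q"
    using first_col_mat_mult_uminus[of n "1 :: 'a"]
    by (simp add: assoc_mult_mat[of _ n n _ n _ n] right_mult_one_mat[of _ n n])
  then have "similar_mat_wit ?A T ?P ?Q"
    using first_col_mat_mult_uminus[of n "1 :: 'a"] first_col_mat_mult_uminus[of n "- 1 :: 'a"]
    by (intro similar_mat_witI[OF _ _ _ const_offdiag_mat_carrier T]) simp_all
  then have "char_poly ?A = char_poly T"
    by (intro char_poly_similar) (auto simp: similar_mat_def)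
  also have "\<dots> = (\<Prod>a\<leftarrow>diag_mat T. [:- a, 1:])"
    by (rule char_poly_upper_triangular[OF T]) (auto simp: T_def)
  also have "diag_mat T = of_nat (n - 1) * c # replicate (n - 1) (- c)"
    using n by (intro nth_equalityI) (auto simp: diag_mat_def T_def nth_Cons split: nat.splits)
  finally show ?thesis by simp
qed

section \<open>Distances 0, 1 and 2 under unit weights\<close>

lemma (in pair_wf_digraph) graph_dist_self:
  assumes "u \<in> pverts G"
  shows "graph_dist G u u = 0"
proof -
  have "\<mu> (\<lambda>_. 1) u u = ereal 0"
    unfolding \<mu>_def
  proof (rule INF_eqI)
    show "y \<le> ereal 0" if "\<And>p. p \<in> {p. awalk u p u} \<Longrightarrow> y \<le> ereal (awalk_cost (\<lambda>_. 1) p)" for y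
      using that[of "[]"] assms by (simp add: awalk_Nil_iff)
  qed (simp add: pos_cost_pos_awalk_cost)
  then show ?thesis by (simp add: graph_dist_def)
qed

lemma (in pair_wf_digraph) awalk_cost_one: "awalk_cost (\<lambda>_. 1) p = real (length p)"
  by (induction p) auto

lemma (in pair_wf_digraph) graph_dist_adjacent:
  assumes uv: "(u, v) \<in> parcs G" and "u \<noteq> v"
  shows "graph_dist G u v = 1"
proof -
  have "\<mu> (\<lambda>_. 1) u v = ereal 1"
    unfolding \<mu>_def
  proof (rule INF_eqI)
    fix p assume "p \<in> {p. awalk u p v}"
    then have "p \<noteq> []" using \<open>u \<noteq> v\<close> by (auto simp: awalk_Nil_iff)
    then show "ereal 1 \<le> ereal (awalk_cost (\<lambda>_. 1) p)"
      by (cases p) (auto simp: awalk_cost_one)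
  next
    have "awalk u [(u, v)] v" using uv by (auto simp: awalk_simps in_arcsD1 in_arcsD2)
    then show "y \<le> ereal 1" if "\<And>p. p \<in> {p. awalk u p v} \<Longrightarrow> y \<le> ereal (awalk_cost (\<lambda>_. 1) p)" for y
      using that[of "[(u, v)]"] by simp
  qed
  then show ?thesis by (simp add: graph_dist_def)
qed

text \<open>An empty walk would force u = v and a walk of length 1 an arc from u to v, while the
  walk through w attains 2.\<close>

lemma (in pair_wf_digraph) graph_dist_common_neighbour:
  assumes uw: "(u, w) \<in> parcs G" "(w, v) \<in> parcs G" and "u \<noteq> v" and uv: "(u, v) \<notin> parcs G"
  shows "graph_dist G u v = 2"
proof -
  have "\<mu> (\<lambda>_. 1) u v = ereal 2"
    unfolding \<mu>_def
  proof (rule INF_eqI)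
    fix p assume "p \<in> {p. awalk u p v}"
    then have p: "awalk u p v" by simp
    have "p \<noteq> []" using p \<open>u \<noteq> v\<close> by (metis awalk_Nil_iff)
    moreover have "p \<noteq> [e]" for e
      using p uv by (cases e) (auto simp: awalk_Cons_iff awalk_Nil_iff)
    ultimately have "2 \<le> length p"
      by (cases p; cases "tl p") auto
    then show "ereal 2 \<le> ereal (awalk_cost (\<lambda>_. 1) p)"
      by (simp add: awalk_cost_one)
  next
    have "awalk u [(u, w), (w, v)] v" using uw by (auto simp: awalk_simps in_arcsD1 in_arcsD2)
    then show "y \<le> ereal 2" if "\<And>p. p \<in> {p. awalk u p v} \<Longrightarrow> y \<le> ereal (awalk_cost (\<lambda>_. 1) p)" for y
      using that[of "[(u, w), (w, v)]"] by simp
  qed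
  then show ?thesis by (simp add: graph_dist_def)
qed

text \<open>The arc map of an isomorphism is injective with image \<open>parcs H\<close>. The arc
  count is the invariant that later tells complete bipartite graphs of the same order apart.\<close>

lemma isomorphic_imp_card_parcs_eq:
  assumes "isomorphic G H"
  shows "card (parcs G) = card (parcs H)"
proof -
  obtain f where f: "pre_digraph.digraph_isomorphism (with_proj G) f" "with_proj H = app_iso f (with_proj G)"
    using assms by (auto simp: digraph_iso_def)
  have "parcs H = iso_arcs f ` parcs G"
    using arg_cong[OF f(2), of arcs] by simp
  then show ?thesis
    using pre_digraph.digraph_isomorphism_inj_on_arcs[OF f(1)] by (simp add: card_image)
qed

section \<open>Complete bipartite graphs: distances, eps-spectrum, eps-energy\<close>

definition complete_bipartite :: "nat \<Rightarrow> nat \<Rightarrow> nat pair_pre_digraph" where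
  "complete_bipartite a b = \<lparr>pverts = {..<a + b},
     parcs = {..<a} \<times> {a..<a + b} \<union> {a..<a + b} \<times> {..<a}\<rparr>"

lemma pverts_complete_bipartite [simp]: "pverts (complete_bipartite a b) = {..<a + b}"
  by (simp add: complete_bipartite_def)

lemma in_parcs_complete_bipartite:
  "(u, v) \<in> parcs (complete_bipartite a b) \<longleftrightarrow> u < a + b \<and> v < a + b \<and> (u < a) \<noteq> (v < a)"
  by (auto simp: complete_bipartite_def)

lemma card_parcs_complete_bipartite: "card (parcs (complete_bipartite a b)) = 2 * a * b"
  by (subst complete_bipartite_def, simp, subst card_Un_disjoint)
    (auto simp: card_cartesian_product)

lemma pair_graph_complete_bipartite: "pair_graph (complete_bipartite a b)"
proof
  show "symmetric (with_proj (complete_bipartite a b))"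
    by (auto simp: symmetric_def intro!: symI simp: in_parcs_complete_bipartite)
qed (auto simp: complete_bipartite_def)

lemma pair_wf_digraph_complete_bipartite: "pair_wf_digraph (complete_bipartite a b)"
  by unfold_locales (auto simp: complete_bipartite_def)

lemma graph_dist_complete_bipartite:
  assumes "a > 0" "b > 0" "u < a + b" "v < a + b"
  shows "graph_dist (complete_bipartite a b) u v
    = (if u = v then 0 else if (u < a) = (v < a) then 2 else 1)"
proof -
  note wf = pair_wf_digraph_complete_bipartite[of a b]
  \<comment> \<open>A neighbour of \<open>u\<close>, namely the first vertex of the opposite part;
    it is also a neighbour of \<open>v\<close> if \<open>v\<close> lies in the part of
    \<open>u\<close>.\<close>
  define w where "w = (if u < a then a else 0)"
  have "graph_dist (complete_bipartite a b) u v = 2" if "u \<noteq> v" "(u < a) = (v < a)"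
    using that assms
    by (intro pair_wf_digraph.graph_dist_common_neighbour[OF wf, of u w]) (auto simp: in_parcs_complete_bipartite w_def)
  moreover have "graph_dist (complete_bipartite a b) u v = 1" if "(u < a) \<noteq> (v < a)"
    using that assms by (intro pair_wf_digraph.graph_dist_adjacent[OF wf]) (auto simp: in_parcs_complete_bipartite)
  ultimately show ?thesis
    using assms pair_wf_digraph.graph_dist_self[OF wf, of u] by auto
qed

text \<open>A second vertex in the part of u attains distance 2. In a part of size 1 the only vertex
  would have eccentricity 1.\<close>

lemma eccentricity_complete_bipartite:
  assumes "a \<ge> 2" "b \<ge> 2" "u < a + b"
  shows "eccentricity (complete_bipartite a b) u = 2"
  unfolding eccentricity_def
proof (rule Max_eqI)
  obtain v where "v < a + b" "v \<noteq> u" "(u < a) = (v < a)"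
  proof (cases "u < a")
    case True
    then show ?thesis using assms that[of "if u = 0 then 1 else 0"] by simp
  next
    case False
    then show ?thesis using assms that[of "if u = a then a + 1 else a"] by simp
  qed
  then have "graph_dist (complete_bipartite a b) u v = 2"
    using assms by (simp add: graph_dist_complete_bipartite)
  with \<open>v < a + b\<close> show "2 \<in> graph_dist (complete_bipartite a b) u ` pverts (complete_bipartite a b)"
    by (metis image_eqI lessThan_iff pverts_complete_bipartite)
qed (use assms in \<open>auto simp: graph_dist_complete_bipartite\<close>)

text \<open>Each part is an interval of indices, so the surviving distances 2 fill two diagonal
  blocks; distances 1 across the parts stay below the minimum 2 and become 0.\<close>

lemma eps_matrix_complete_bipartite:
  assumes "a \<ge> 2" "b \<ge> 2"
  shows "eps_matrix (complete_bipartite a b)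
    = four_block_mat (const_offdiag_mat a 2) (0\<^sub>m a b) (0\<^sub>m b a) (const_offdiag_mat b 2)"
  using assms
  by (intro eq_matI)
    (auto simp: eps_matrix_def const_offdiag_mat_def graph_dist_complete_bipartite
      eccentricity_complete_bipartite)

text \<open>The positive eigenvalues are written as casts of naturals, so that comparing spectra and
  taking absolute values reduces to arithmetic in the naturals.\<close>

lemma eps_spectrum_complete_bipartite:
  assumes "a \<ge> 2" "b \<ge> 2"
  shows "eps_spectrum (complete_bipartite a b)
    = {#of_nat (2 * (a - 1)), of_nat (2 * (b - 1))#} + replicate_mset (a + b - 2) (- 2)"
proof -
  have "map_mat complex_of_real (eps_matrix (complete_bipartite a b))
    = four_block_mat (const_offdiag_mat a 2) (0\<^sub>m a b) (0\<^sub>m b a) (const_offdiag_mat b 2)"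
    unfolding eps_matrix_complete_bipartite[OF assms]
    by (intro eq_matI) (auto simp: const_offdiag_mat_def)
  then have "char_poly (map_mat complex_of_real (eps_matrix (complete_bipartite a b)))
    = ([:- (of_nat (a - 1) * 2), 1:] * [:2, 1:] ^ (a - 1))
      * ([:- (of_nat (b - 1) * 2), 1:] * [:2, 1:] ^ (b - 1))"
    using assms
    by (simp only: char_poly_four_block_lower_left_zero[OF const_offdiag_mat_carrier _ const_offdiag_mat_carrier]
        zero_carrier_mat char_poly_const_offdiag_mat)
  moreover have "a + b - 2 = (a - 1) + (b - 1)"
    using assms by simp
  ultimately show ?thesis
    unfolding eps_spectrum_def
    by (simp add: proots_mult proots_power multiset_eq_iff mult.commute[of 2]
        del: mult_pCons_left mult_pCons_right)
qed

text \<open>The two positive eigenvalues sum to 2 (a + b - 2), which balances the a + b - 2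
  eigenvalues -2, as the trace is 0.\<close>

lemma eps_energy_complete_bipartite:
  assumes "a \<ge> 2" "b \<ge> 2"
  shows "eps_energy (complete_bipartite a b) = 4 * real (a + b - 2)"
proof -
  have "eps_energy (complete_bipartite a b)
    = real (2 * (a - 1)) + real (2 * (b - 1)) + 2 * real (a + b - 2)"
    unfolding eps_energy_def eps_spectrum_complete_bipartite[OF assms]
    by (simp del: of_nat_mult)
  then show ?thesis using assms by (simp add: of_nat_diff)
qed

lemma connected_graph_of_order_complete_bipartite:
  assumes "a > 0" "b > 0"
  shows "connected_graph_of_order (a + b) (complete_bipartite a b)"
proof -
  let ?G = "complete_bipartite a b"
  have wf: "wf_digraph (with_proj ?G)"
    by (simp add: wf_digraph_wp_iff pair_wf_digraph_complete_bipartite)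
  have "u \<rightarrow>\<^sup>*\<^bsub>with_proj ?G\<^esub> v" if "u < a + b" "v < a + b" for u v
  proof -
    \<comment> \<open>Vertices in different parts are joined by an arc; two in the same part, equal
      or not, are joined through \<open>w\<close> in the opposite part.\<close>
    define w where "w = (if u < a then a else 0)"
    have arc: "x \<rightarrow>\<^sup>*\<^bsub>with_proj ?G\<^esub> y" if "x < a + b" "y < a + b" "(x < a) \<noteq> (y < a)" for x y
      using that by (intro wf_digraph.reachable_adjI[OF wf]) (simp add: in_parcs_complete_bipartite)
    show ?thesis
    proof (cases "(u < a) = (v < a)")
      case True
      then have "u \<rightarrow>\<^sup>*\<^bsub>with_proj ?G\<^esub> w" "w \<rightarrow>\<^sup>*\<^bsub>with_proj ?G\<^esub> v"
        using that assms by (auto intro!: arc simp: w_def)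
      then show ?thesis by (rule wf_digraph.reachable_trans[OF wf])
    qed (use that arc in auto)
  qed
  then have "Digraph_Component.connected (with_proj ?G)"
    using assms unfolding Digraph_Component.connected_def strongly_connected_def
    by (auto intro!: wf_digraph.reachable_mk_symmetricI[OF wf] simp: lessThan_empty_iff)
  then show ?thesis
    by (simp add: connected_graph_of_order_def pair_graph_complete_bipartite)
qed

text \<open>For a < a' \<le> n / 2 the largest eigenvalue 2 (n - a - 1) of the first graph exceeds
  every eigenvalue of the second, and the number of arcs 2 a (n - a) grows strictly with a.\<close>

lemma non_eps_cospectral_complete_bipartite:
  assumes "2 \<le> a" "a < a'" "2 * a' \<le> n"
  shows "non_eps_cospectral (complete_bipartite a (n - a)) (complete_bipartite a' (n - a'))"
    and "non_eps_cospectral (complete_bipartite a' (n - a')) (complete_bipartite a (n - a))"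
proof -
  let ?G = "complete_bipartite a (n - a)" and ?H = "complete_bipartite a' (n - a')"
  have "of_nat (2 * (n - a - 1)) \<in># eps_spectrum ?G"
    using assms by (subst eps_spectrum_complete_bipartite) auto
  moreover have "of_nat (2 * (n - a - 1)) \<notin># eps_spectrum ?H"
  proof -
    have "2 * (n - a - 1) \<noteq> 2 * (a' - 1)" "2 * (n - a - 1) \<noteq> 2 * (n - a' - 1)"
      using assms by arith+
    moreover have "of_nat m \<noteq> (- 2 :: complex)" for m
      by (simp add: complex_eq_iff)
    ultimately have "of_nat (2 * (n - a - 1)) \<notin>
        {of_nat (2 * (a' - 1)), of_nat (2 * (n - a' - 1)), - 2 :: complex}"
      by (simp only: insert_iff empty_iff of_nat_eq_iff simp_thms)
    moreover have "set_mset (eps_spectrum ?H)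
        \<subseteq> {of_nat (2 * (a' - 1)), of_nat (2 * (n - a' - 1)), - 2}"
      using assms by (subst eps_spectrum_complete_bipartite) auto
    ultimately show ?thesis by blast
  qed
  ultimately have "eps_spectrum ?G \<noteq> eps_spectrum ?H" by auto
  moreover have "a * (n - a) < a' * (n - a')"
  proof -
    \<comment> \<open>In terms of \<open>d\<close> and \<open>e\<close> below, the difference of the
      two products is d (d + e).\<close>
    obtain d where d: "a' = a + d" "d > 0"
      using assms less_imp_add_positive by blast
    obtain e where "n = 2 * a' + e"
      using assms le_Suc_ex by blast
    then have "n - a = a + 2 * d + e" "n - a' = a + d + e"
      using d by auto
    then show ?thesis
      using d by (simp add: algebra_simps)
  qed
  then have "\<not> isomorphic ?G ?H" "\<not> isomorphic ?H ?G"
    using isomorphic_imp_card_parcs_eq[of ?G ?H] isomorphic_imp_card_parcs_eq[of ?H ?G]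
    by (auto simp: card_parcs_complete_bipartite)
  ultimately show "non_eps_cospectral ?G ?H" "non_eps_cospectral ?H ?G"
    using assms by (simp_all add: non_eps_cospectral_def)
qed

section \<open>Triplets of complete bipartite graphs of equal order\<close>

lemma equienergetic_triplet_complete_bipartite:
  assumes "2 \<le> a" "a < b" "b < c" "2 * c \<le> n"
  shows "equienergetic_triplet n ((\<lambda>k. complete_bipartite k (n - k)) ` {a, b, c})"
proof -
  let ?K = "\<lambda>k. complete_bipartite k (n - k)"
  define S where "S = {a, b, c}"
  \<comment> \<open>Every index is the size of a smallest part, as the comparison of spectra
    requires.\<close>
  have range: "2 \<le> k" "2 * k \<le> n" if "k \<in> S" for k
    using that assms by (auto simp: S_def)
  have cospec: "non_eps_cospectral (?K k) (?K l)" if "k \<in> S" "l \<in> S" "k \<noteq> l" for k l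
  proof (cases "k < l")
    case True
    then show ?thesis
      using range that by (intro non_eps_cospectral_complete_bipartite(1)) simp_all
  next
    case False
    then show ?thesis
      using range that by (intro non_eps_cospectral_complete_bipartite(2)) simp_all
  qed
  \<comment> \<open>Since \<open>non_eps_cospectral\<close> is irreflexive, distinct indices give
    distinct graphs.\<close>
  then have "inj_on ?K S"
    by (intro inj_onI) (metis non_eps_cospectral_def)
  moreover have "card S = 3"
    using assms by (simp add: S_def)
  ultimately have "card (?K ` S) = 3"
    by (simp add: card_image)
  moreover have "connected_graph_of_order n (?K k)" if "k \<in> S" for k
    using range[OF that] connected_graph_of_order_complete_bipartite[of k "n - k"] by simp
  moreover have "pairwise non_eps_cospectral (?K ` S)"
    using cospec by (intro pairwise_imageI) simp
  moreover have "pairwise eps_equienergetic (?K ` S)"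
  proof (rule pairwise_imageI)
    fix k l assume "k \<in> S" "l \<in> S"
    then show "eps_equienergetic (?K k) (?K l)"
      using range[of k] range[of l]
      by (simp add: eps_equienergetic_def eps_energy_complete_bipartite)
  qed
  ultimately have "equienergetic_triplet n (?K ` S)"
    unfolding equienergetic_triplet_def by blast
  then show ?thesis by (simp only: S_def)
qed

theorem corollary5p7:
  fixes t :: nat
  assumes "t \<ge> 3"
  shows "\<exists>T1 T2. equienergetic_triplet (6 + 12 * t) T1 \<and> equienergetic_triplet (6 + 12 * t) T2 \<and>
           \<not> same_up_to_iso T1 T2"
proof -
  define n where "n = 6 + 12 * t"
  let ?K = "\<lambda>k. complete_bipartite k (n - k)"
  \<comment> \<open>The largest index is 5 and must satisfy 2 * 5 \<le> n.\<close>
  have n: "10 \<le> n" using assms by (simp add: n_def)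
  \<comment> \<open>K(4, n - 4) belongs to the first triplet and is isomorphic to no member of the
    second, which separates the triplets.\<close>
  have "non_eps_cospectral (?K 4) (?K 2)" "non_eps_cospectral (?K 4) (?K 3)"
      "non_eps_cospectral (?K 4) (?K 5)"
    using n by (intro non_eps_cospectral_complete_bipartite; simp)+
  then have "\<not> isomorphic (?K 4) (?K k)" if "k \<in> {2, 3, 5}" for k
    using that unfolding non_eps_cospectral_def by blast
  then have "\<not> same_up_to_iso (?K ` {2, 3, 4}) (?K ` {2, 3, 5})"
    unfolding same_up_to_iso_def by blast
  moreover have "equienergetic_triplet n (?K ` {2, 3, 4})" "equienergetic_triplet n (?K ` {2, 3, 5})"
    using n by (intro equienergetic_triplet_complete_bipartite; simp)+
  ultimately show ?thesis unfolding n_def by blast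
qed

end
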